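(* Let $\xi_1,\dots,\xi_n$ be i.i.d. real random variables with characteristic function $\varphi$ satisfying $\inf_{u\in\mathbb{R}}|\varphi(u)|>0$, let $\varphi_n(u)=n^{-1}\sum_{k=1}^ne^{iu\xi_k}$, and let $h_n\to0$ with $\log(h_n^{-1})/n^{1/(1+2\delta)}\to0$ for some $\delta>0$. If $\mathbb{E}[\log^\beta(\max\{|\xi_1|,e\})]<\infty$ for some $\beta>1$, then $\mathrm{Log}(\varphi_n(u)/\varphi(u))\mathbf{1}_{\{|u|\le h_n^{-1}\}}$ is well defined and finite on events whose probability tends to one as $n\to\infty$, and on these events $$\mathrm{Log}\frac{\varphi_n(u)}{\varphi(u)}=(\varphi_n(u)-\varphi(u))\varphi^{-1}(u)+R_n(u),\qquad u\in[-h_n^{-1},h_n^{-1}],$$ where $R_n(u):=R(\varphi_n(u)/\varphi(u))$ with $R(z)=\int_1^z\frac{s-z}{s^2}ds$ (integral along the segment from $1$ to $z$), and $\sup_{|u|\le h_n^{-1}}|R_n(u)|=O_{\mathbb P}\big(n^{-1}(\log h_n^{-1})^{1+2\bar\delta}\big)$ for any $\bar\delta\in(0,\delta]$.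
   Context: $\varphi^{-1}=1/\varphi$. For a continuous nonvanishing function $\psi$ on an interval containing $0$ with $\psi(0)=1$, $\mathrm{Log}\,\psi$ denotes its distinguished logarithm: the unique continuous function with $\mathrm{Log}\,\psi(0)=0$ and $e^{\mathrm{Log}\,\psi}=\psi$. $O_{\mathbb P}(r_n)$: bounded in probability after division by $r_n$. *)

theory Defs
  imports "HOL-Probability.Probability" "HOL-Complex_Analysis.Complex_Analysis"
begin

text \<open>Distinguished logarithm of \<open>\<psi>\<close> on the interval [-T,T]: the continuous function L with
  L 0 = 0 and exp (L v) = \<psi> v on [-T,T]; normalised to 0 outside the interval so that
  it is unique as a function.\<close>
definition dist_log_prop :: "real \<Rightarrow> (real \<Rightarrow> complex) \<Rightarrow> (real \<Rightarrow> complex) \<Rightarrow> bool" where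
  "dist_log_prop T \<psi> L \<longleftrightarrow> continuous_on {-T..T} L \<and> L 0 = 0 \<and>
     (\<forall>v\<in>{-T..T}. exp (L v) = \<psi> v) \<and> (\<forall>v. v \<notin> {-T..T} \<longrightarrow> L v = 0)"

definition dist_log :: "real \<Rightarrow> (real \<Rightarrow> complex) \<Rightarrow> real \<Rightarrow> complex" where
  "dist_log T \<psi> = (THE L. dist_log_prop T \<psi> L)"

definition Rfun :: "complex \<Rightarrow> complex" where
  "Rfun z = contour_integral (linepath 1 z) (\<lambda>s. (s - z) / s^2)"

definition emp_char :: "(nat \<Rightarrow> 'a \<Rightarrow> real) \<Rightarrow> nat \<Rightarrow> 'a \<Rightarrow> real \<Rightarrow> complex" where
  "emp_char \<xi> n \<omega> u = (\<Sum>k<n. iexp (u * \<xi> k \<omega>)) / of_nat n"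

end

theory Submission
  imports Defs
begin

text \<open>
  Where \<open>|z - 1| < 1\<close> one has \<open>R z = Ln z + 1 - z\<close>, and \<open>|R z| \<le> 4 |z - 1|\<^sup>2\<close> for \<open>|z - 1| \<le> 1/2\<close>.
  So everything reduces to showing that the supremum over \<open>|u| \<le> U\<close> of \<open>|\<phi>\<^sub>n u - \<phi> u|\<close> is at
  most \<open>C sqrt (ln U / n)\<close> in expectation.

  Split the real line into the shells where \<open>2^j \<le> ln (max |x| e) < 2^(j+1)\<close>. By the moment
  condition the \<open>j\<close>-th shell has probability \<open>p\<close> of order at most \<open>2^(-j \<beta>)\<close>. On it, expand
  \<open>exp (i u x)\<close> in powers of \<open>x\<close> times the distance from \<open>u\<close> to a grid of mesh \<open>exp (-2^(j+1))\<close>.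
  Each coefficient is taken from a finite class of functions bounded by the indicator of the shell,
  whose log-cardinality is of order \<open>2^j ln U\<close>, and an exponential moment bound gives a deviation of
  order \<open>sqrt (n p 2^j ln U)\<close>. These are summable over \<open>j\<close> since \<open>\<beta> > 1\<close>. The power series
  replaces chaining and avoids the factor \<open>ln n\<close> that a single discretisation of \<open>u\<close> would cost.
\<close>

section \<open>The remainder \<open>Rfun\<close> near 1\<close>

text \<open>On the right half-plane \<open>Ln s + z / s\<close> is a primitive of the integrand. The
  half-plane contains the open unit disc about 1, and by convexity the whole segment.\<close>

lemma Rfun_integral:
  assumes "norm (z - 1) < 1"
  shows "((\<lambda>s. (s - z) / s\<^sup>2) has_contour_integral (Ln z + 1 - z)) (linepath 1 z)"
proof -
  have re: "0 < Re z"
    using assms abs_Re_le_cmod[of "z - 1"] by simp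
  have "((\<lambda>s. (s - z) / s\<^sup>2) has_contour_integral
      ((Ln (pathfinish (linepath 1 z)) + z / pathfinish (linepath 1 z))
        - (Ln (pathstart (linepath 1 z)) + z / pathstart (linepath 1 z)))) (linepath 1 z)"
  proof (rule contour_integral_primitive[where S="{s. 0 < Re s}"])
    fix s :: complex assume s: "s \<in> {s. 0 < Re s}"
    then have "s \<noteq> 0" "s \<notin> \<real>\<^sub>\<le>\<^sub>0" by (auto simp: complex_nonpos_Reals_iff)
    then show "((\<lambda>s. Ln s + z / s) has_field_derivative (s - z) / s\<^sup>2) (at s within {s. 0 < Re s})"
      by (auto intro!: derivative_eq_intros simp: field_simps power2_eq_square)
  next
    show "path_image (linepath 1 z) \<subseteq> {s. 0 < Re s}"
      using re by (simp add: closed_segment_subset convex_halfspace_Re_gt)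
  qed simp
  then show ?thesis using re by (cases "z = 0") (auto simp: diff_diff_eq2 algebra_simps)
qed

lemma Rfun_eq: "norm (z - 1) < 1 \<Longrightarrow> Rfun z = Ln z + 1 - z"
  unfolding Rfun_def by (rule contour_integral_unique[OF Rfun_integral])

text \<open>One factor \<open>norm (z - 1)\<close> is the length of the segment, the other bounds
  \<open>norm (s - z)\<close> on it. The 4 comes from \<open>norm s \<ge> 1/2\<close> in the
  denominator.\<close>

lemma norm_Rfun_le:
  assumes z: "norm (z - 1) \<le> 1/2"
  shows "norm (Rfun z) \<le> 4 * (norm (z - 1))\<^sup>2"
proof -
  have "norm (Ln z + 1 - z) \<le> 4 * norm (z - 1) * norm (z - 1)"
  proof (rule has_contour_integral_bound_linepath[OF Rfun_integral])
    fix s assume s: "s \<in> closed_segment 1 z"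
    have sz: "norm (s - z) \<le> norm (z - 1)" "norm (s - 1) \<le> norm (z - 1)"
      using segment_bound[OF s] by (simp_all add: norm_minus_commute)
    have "1/2 \<le> norm s"
      using sz(2) z norm_triangle_ineq2[of 1 "1 - s"] by (simp add: norm_minus_commute)
    then have "1/4 \<le> (norm s)\<^sup>2"
      using power_mono[of "1/2" "norm s" 2] by (simp add: power2_eq_square)
    then have "norm (s - z) / (norm s)\<^sup>2 \<le> norm (z - 1) / (1/4)"
      using sz(1) by (intro frac_le) auto
    then show "norm ((s - z) / s\<^sup>2) \<le> 4 * norm (z - 1)"
      by (simp add: norm_divide norm_power)
  qed (use z in auto)
  then show ?thesis using z by (simp add: Rfun_eq power2_eq_square)
qed

section \<open>The distinguished logarithm\<close>

text \<open>The difference of two continuous logarithms takes values in the integer multiples of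
  \<open>2 * pi * \<i>\<close>. These are separated by \<open>2 * pi\<close>, so on a connected set
  the difference is constant.\<close>

lemma continuous_log_unique:
  fixes L L' :: "'a::topological_space \<Rightarrow> complex"
  assumes "connected S" "continuous_on S L" "continuous_on S L'"
    and expeq: "\<And>v. v \<in> S \<Longrightarrow> exp (L v) = exp (L' v)"
    and a: "a \<in> S" "L a = L' a" and "v \<in> S"
  shows "L v = L' v"
proof -
  have "(\<lambda>v. L v - L' v) constant_on S"
  proof (rule continuous_discrete_range_constant)
    fix x assume x: "x \<in> S"
    have "2 * pi \<le> norm ((L y - L' y) - (L x - L' x))"
      if y: "y \<in> S" "L y - L' y \<noteq> L x - L' x" for y
    proof -
      obtain i j :: int where "L y = L' y + of_int (2 * i) * pi * \<i>" "L x = L' x + of_int (2 * j) * pi * \<i>"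
        using expeq[OF y(1)] expeq[OF x] by (auto simp: exp_eq)
      then have eq: "(L y - L' y) - (L x - L' x) = of_int (2 * (i - j)) * (pi * \<i>)"
        by (simp add: algebra_simps)
      with y have "i \<noteq> j" by auto
      then have "1 \<le> \<bar>real_of_int (i - j)\<bar>" by linarith
      then have "2 * pi \<le> 2 * \<bar>real_of_int (i - j)\<bar> * pi" by simp
      then show ?thesis
        unfolding eq by (simp add: norm_mult del: of_int_diff)
    qed
    then show "\<exists>e>0. \<forall>y. y \<in> S \<and> L y - L' y \<noteq> L x - L' x \<longrightarrow> e \<le> norm ((L y - L' y) - (L x - L' x))"
      by (intro exI[of _ "2 * pi"]) auto
  qed (use assms in \<open>auto intro: continuous_on_diff\<close>)
  then have "L v - L' v = L a - L' a"
    using a \<open>v \<in> S\<close> unfolding constant_on_def by metis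
  then show ?thesis using a by simp
qed

lemma dist_log_prop_unique:
  assumes T: "0 < T" and L: "dist_log_prop T \<psi> L" "dist_log_prop T \<psi> L'"
  shows "L = L'"
proof
  fix v
  show "L v = L' v"
  proof (cases "v \<in> {-T..T}")
    case True
    show ?thesis
      by (rule continuous_log_unique[of "{-T..T}" _ _ 0]) (use L T True in \<open>auto simp: dist_log_prop_def\<close>)
  qed (use L in \<open>auto simp: dist_log_prop_def\<close>)
qed

text \<open>The values of \<open>\<psi>\<close> stay in the right half-plane, where the principal
  branch is continuous. Composing with \<open>Ln\<close> and cutting off to 0 outside the interval
  therefore gives the required function.\<close>

lemma dist_log_near_one:
  assumes T: "0 < T" and cont: "continuous_on {-T..T} \<psi>" and "\<psi> 0 = 1"
    and near: "\<And>u. \<bar>u\<bar> \<le> T \<Longrightarrow> norm (\<psi> u - 1) < 1"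
  shows "\<exists>!L. dist_log_prop T \<psi> L"
    and "\<bar>u\<bar> \<le> T \<Longrightarrow> dist_log T \<psi> u = Ln (\<psi> u)"
proof -
  define L where "L v = (if \<bar>v\<bar> \<le> T then Ln (\<psi> v) else 0)" for v
  have pos: "0 < Re (\<psi> u)" if "\<bar>u\<bar> \<le> T" for u
    using near[OF that] abs_Re_le_cmod[of "\<psi> u - 1"] by simp
  have L: "dist_log_prop T \<psi> L"
    unfolding dist_log_prop_def
  proof (intro conjI ballI allI impI)
    have "continuous_on {-T..T} (\<lambda>v. Ln (\<psi> v))"
      using pos by (intro continuous_on_Ln' cont) (force simp: complex_nonpos_Reals_iff abs_le_iff)
    then show "continuous_on {-T..T} L"
      by (rule continuous_on_eq) (auto simp: L_def)
    show "L 0 = 0" using T \<open>\<psi> 0 = 1\<close> by (simp add: L_def)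
    show "exp (L v) = \<psi> v" if "v \<in> {-T..T}" for v
      using that pos[of v] by (cases "\<psi> v = 0") (auto simp: L_def abs_le_iff)
    show "L v = 0" if "v \<notin> {-T..T}" for v
      using that by (auto simp: L_def)
  qed
  show ex1: "\<exists>!L. dist_log_prop T \<psi> L"
    using L dist_log_prop_unique[OF T] by blast
  have "dist_log T \<psi> = L"
    unfolding dist_log_def using ex1 L by (intro the1_equality)
  then show "dist_log T \<psi> u = Ln (\<psi> u)" if "\<bar>u\<bar> \<le> T"
    using that by (simp add: L_def)
qed

section \<open>Exponential moments of centred sums\<close>

lemma exp_le_quadratic:
  fixes x :: real
  assumes "\<bar>x\<bar> \<le> 1"
  shows "exp x \<le> 1 + x + x\<^sup>2"
proof (cases "0 \<le> x")
  case True
  then show ?thesis using exp_bound[of x] assms by simp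
next
  case False
  define y where "y = - x"
  have y: "0 \<le> y" using False by (simp add: y_def)
  \<comment> \<open>For negative arguments the claim is
    \<open>(1 - y + y^2) * exp y \<ge> 1\<close>. Replacing \<open>exp y\<close> by its quadratic
    Taylor polynomial leaves a product whose expansion is visibly at least 1.\<close>
  have "1 \<le> 1 + (y\<^sup>2 + y ^ 3 + y ^ 4) / 2"
    using y by simp
  also have "\<dots> = (1 - y + y\<^sup>2) * (1 + y + y\<^sup>2 / 2)"
    by (simp add: field_simps power2_eq_square power3_eq_cube power4_eq_xxxx)
  also have "\<dots> \<le> (1 - y + y\<^sup>2) * exp y"
  proof (intro mult_left_mono exp_lower_Taylor_quadratic y)
    have "0 \<le> (y - 1/2)\<^sup>2" by simp
    then show "0 \<le> 1 - y + y\<^sup>2" by (simp add: power2_eq_square algebra_simps)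
  qed
  finally have "exp (- y) \<le> 1 - y + y\<^sup>2"
    by (simp add: exp_minus divide_simps mult.commute)
  then show ?thesis by (simp add: y_def)
qed

locale iid_sample = prob_space M for M :: "'a measure" +
  fixes X :: "nat \<Rightarrow> 'a \<Rightarrow> real" and \<mu> :: "real measure"
  assumes indep: "indep_vars (\<lambda>_. borel) X UNIV"
    and ident: "\<And>k. distr M borel (X k) = \<mu>"
begin

lemma X_measurable [measurable]: "X k \<in> borel_measurable M"
  using indep by (auto simp: indep_vars_def)

sublocale D: real_distribution \<mu>
proof -
  interpret N: prob_space \<mu>
    unfolding ident[of 0, symmetric] by (rule prob_space_distr) simp
  show "real_distribution \<mu>"
    by unfold_locales (simp_all add: ident[of 0, symmetric])
qed

lemma prob_\<mu>_UNIV: "measure \<mu> UNIV = 1"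
  using D.prob_space by simp

text \<open>The sum is not divided by \<open>n\<close>: for \<open>f x = iexp (u * x)\<close> it is
  \<open>n\<close> times the empirical minus the true characteristic function. The target space is
  general so that real and complex functions share one notion.\<close>

definition dev :: "nat \<Rightarrow> (real \<Rightarrow> 'b) \<Rightarrow> 'a \<Rightarrow> 'b :: {banach, second_countable_topology}"
  where "dev n f \<omega> = (\<Sum>k<n. f (X k \<omega>) - (\<integral>x. f x \<partial>\<mu>))"

lemma expectation_comp_X:
  fixes f :: "real \<Rightarrow> 'b :: {banach, second_countable_topology}"
  assumes [measurable]: "f \<in> borel_measurable borel"
  shows "(\<integral>\<omega>. f (X k \<omega>) \<partial>M) = (\<integral>x. f x \<partial>\<mu>)"
  unfolding ident[of k, symmetric] by (rule integral_distr[symmetric]) auto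

lemma integrable_bounded:
  fixes f :: "real \<Rightarrow> 'b :: {banach, second_countable_topology}"
  assumes "f \<in> borel_measurable borel" "\<And>x. norm (f x) \<le> B"
  shows "integrable \<mu> f"
  by (rule D.integrable_const_bound[of _ B]) (use assms in auto)

text \<open>A Bernstein-type bound. Since \<open>\<bar>g x - m\<bar> \<le> 2\<close>, the exponent
  stays in [-1,1] and \<open>exp_le_quadratic\<close> applies; integrating removes the linear term
  and leaves the variance, at most \<open>measure \<mu> A\<close> because \<open>(g x)^2\<close> is
  below the indicator. Independence raises this to the power \<open>n\<close>. Keeping
  \<open>measure \<mu> A\<close> instead of 1 is what later makes remote shells cheap.\<close>

lemma mgf_dev_le:
  fixes g :: "real \<Rightarrow> real"
  assumes g[measurable]: "g \<in> borel_measurable borel" and A[measurable]: "A \<in> sets borel"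
    and le: "\<And>x. \<bar>g x\<bar> \<le> indicator A x" and t: "\<bar>t\<bar> \<le> 1/2"
  shows "integrable M (\<lambda>\<omega>. exp (t * dev n g \<omega>))"
    and "(\<integral>\<omega>. exp (t * dev n g \<omega>) \<partial>M) \<le> exp (t\<^sup>2 * (n * measure \<mu> A))"
proof -
  define m where "m = (\<integral>x. g x \<partial>\<mu>)"
  define Y where "Y x = exp (t * (g x - m))" for x
  have g1: "\<bar>g x\<bar> \<le> 1" for x
    by (rule order_trans[OF le]) (simp add: indicator_def)
  have int_g: "integrable \<mu> g"
    using g1 by (intro integrable_bounded[where B=1]) auto
  have m1: "\<bar>m\<bar> \<le> 1"
  proof -
    have "\<bar>m\<bar> \<le> (\<integral>x. \<bar>g x\<bar> \<partial>\<mu>)" unfolding m_def by (rule integral_abs_bound)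
    also have "\<dots> \<le> (\<integral>x. 1 \<partial>\<mu>)" using g1 int_g by (intro integral_mono) auto
    finally show ?thesis by (simp add: prob_\<mu>_UNIV)
  qed
  have arg: "\<bar>t * (g x - m)\<bar> \<le> 1" for x
  proof -
    have "\<bar>t\<bar> * \<bar>g x - m\<bar> \<le> 1/2 * 2"
      using t g1[of x] m1 by (intro mult_mono) auto
    then show ?thesis by (simp add: abs_mult)
  qed
  have [measurable]: "Y \<in> borel_measurable borel" unfolding Y_def by measurable
  have Yb: "\<bar>Y x\<bar> \<le> exp 1" for x using arg[of x] by (auto simp: Y_def)
  have int_Y: "integrable \<mu> Y"
    using Yb by (intro integrable_bounded[where B="exp 1"]) auto
  have int_g2: "integrable \<mu> (\<lambda>x. (g x)\<^sup>2)"
    using g1 by (intro integrable_bounded[where B=1]) (auto simp: abs_square_le_1)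
  have EY: "(\<integral>x. Y x \<partial>\<mu>) \<le> exp (t\<^sup>2 * measure \<mu> A)"
  proof -
    have "(\<integral>x. Y x \<partial>\<mu>) \<le> (\<integral>x. 1 + t * (g x - m) + t\<^sup>2 * ((g x)\<^sup>2 - 2 * m * g x + m\<^sup>2) \<partial>\<mu>)"
    proof (intro integral_mono int_Y)
      show "integrable \<mu> (\<lambda>x. 1 + t * (g x - m) + t\<^sup>2 * ((g x)\<^sup>2 - 2 * m * g x + m\<^sup>2))"
        using int_g int_g2 by simp
      fix x
      show "Y x \<le> 1 + t * (g x - m) + t\<^sup>2 * ((g x)\<^sup>2 - 2 * m * g x + m\<^sup>2)"
        using exp_le_quadratic[OF arg[of x]]
        by (simp add: Y_def power2_eq_square algebra_simps)
    qed
    also have "\<dots> = 1 + t\<^sup>2 * ((\<integral>x. (g x)\<^sup>2 \<partial>\<mu>) - m\<^sup>2)"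
      using int_g int_g2
      by (simp add: prob_\<mu>_UNIV m_def[symmetric] power2_eq_square algebra_simps)
    also have "\<dots> \<le> 1 + t\<^sup>2 * measure \<mu> A"
    proof -
      have "(\<integral>x. (g x)\<^sup>2 \<partial>\<mu>) \<le> (\<integral>x. indicator A x \<partial>\<mu>)"
      proof (intro integral_mono int_g2)
        show "integrable \<mu> (indicator A :: real \<Rightarrow> real)"
          by (intro integrable_bounded[where B=1]) (auto simp: indicator_def)
        fix x show "(g x)\<^sup>2 \<le> indicator A x"
          using le[of x] by (cases "x \<in> A") (auto simp: abs_square_le_1)
      qed
      then have "(\<integral>x. (g x)\<^sup>2 \<partial>\<mu>) - m\<^sup>2 \<le> measure \<mu> A"
        by (simp add: algebra_simps add_increasing2)
      then show ?thesis by (intro add_left_mono mult_left_mono) auto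
    qed
    also have "\<dots> \<le> exp (t\<^sup>2 * measure \<mu> A)" by (rule exp_ge_add_one_self)
    finally show ?thesis .
  qed
  have eq: "exp (t * dev n g \<omega>) = (\<Prod>k<n. Y (X k \<omega>))" for \<omega>
    by (simp add: dev_def Y_def m_def sum_distrib_left exp_sum)
  have ind: "indep_vars (\<lambda>_. borel) (\<lambda>k \<omega>. Y (X k \<omega>)) {..<n}"
    by (rule indep_vars_compose2[OF indep_vars_subset[OF indep]]) auto
  have int: "integrable M (\<lambda>\<omega>. Y (X k \<omega>))" for k
    using Yb by (intro integrable_const_bound[of _ "exp 1"]) auto
  show "integrable M (\<lambda>\<omega>. exp (t * dev n g \<omega>))"
    unfolding eq by (rule indep_vars_integrable[OF _ ind int]) auto
  have "(\<integral>\<omega>. exp (t * dev n g \<omega>) \<partial>M) = (\<integral>x. Y x \<partial>\<mu>) ^ n"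
    unfolding eq by (subst indep_vars_lebesgue_integral[OF _ ind int]) (auto simp: expectation_comp_X)
  also have "\<dots> \<le> exp (t\<^sup>2 * measure \<mu> A) ^ n"
    using EY by (intro power_mono) (auto simp: Y_def intro!: integral_nonneg)
  finally show "(\<integral>\<omega>. exp (t * dev n g \<omega>) \<partial>M) \<le> exp (t\<^sup>2 * (n * measure \<mu> A))"
    by (simp add: exp_of_nat_mult[symmetric] algebra_simps)
qed


text \<open>The supremum of the deviations over \<open>F\<close> is controlled through a measurable majorant, so that
  its own measurability never matters.\<close>

definition dev_bound :: "nat \<Rightarrow> (real \<Rightarrow> complex) set \<Rightarrow> ennreal \<Rightarrow> bool"
  where "dev_bound n F C \<longleftrightarrow> (\<exists>V \<in> borel_measurable M.
    (\<forall>f\<in>F. \<forall>\<omega>\<in>space M. ennreal (norm (dev n f \<omega>)) \<le> V \<omega>) \<and> (\<integral>\<^sup>+\<omega>. V \<omega> \<partial>M) \<le> C)"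

lemma dev_bound_mono: "dev_bound n F C \<Longrightarrow> F' \<subseteq> F \<Longrightarrow> C \<le> C' \<Longrightarrow> dev_bound n F' C'"
  unfolding dev_bound_def by (meson order_trans subsetD)

section \<open>Maximal inequalities for finite classes\<close>

text \<open>With \<open>q = n * measure \<mu> A\<close>, the optimal exponent
  \<open>sqrt (L / q)\<close> is admissible in \<open>mgf_dev_le\<close> exactly when
  \<open>4 * L \<le> q\<close>. The complementary case is treated separately, so that one
  square-root bound covers both and no additional term linear in \<open>L\<close> appears.\<close>

lemma finite_class_maximal_ineq:
  fixes g :: "'i \<Rightarrow> real \<Rightarrow> real"
  assumes J: "finite J" "J \<noteq> {}" and g: "\<And>i. i \<in> J \<Longrightarrow> g i \<in> borel_measurable borel"
    and A[measurable]: "A \<in> sets borel"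
    and le: "\<And>i x. i \<in> J \<Longrightarrow> \<bar>g i x\<bar> \<le> indicator A x"
    and L: "0 < L" and card: "2 * card J \<le> exp L"
  obtains V where "V \<in> borel_measurable M"
    "\<And>i \<omega>. i \<in> J \<Longrightarrow> \<omega> \<in> space M \<Longrightarrow> \<bar>dev n (g i) \<omega>\<bar> \<le> V \<omega>"
    "(\<integral>\<^sup>+\<omega>. ennreal (V \<omega>) \<partial>M) \<le> ennreal (4 * sqrt (n * measure \<mu> A * L))"
proof (cases "4 * L \<le> n * measure \<mu> A")
  case True
  define q where "q = n * measure \<mu> A"
  have q: "0 < q" "4 * L \<le> q" using True L by (auto simp: q_def)
  \<comment> \<open>The maximum is bounded by a sum of exponentials via \<open>y \<le> a - 1 + exp (y - a)\<close> with \<open>a = 2 * L\<close>.\<close>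
  define t where "t = sqrt (L / q)"
  have t: "0 < t" "\<bar>t\<bar> \<le> 1/2"
  proof -
    show "0 < t" using L q by (simp add: t_def)
    have "L / q \<le> 1/4" using q by (simp add: divide_simps)
    then have "sqrt (L / q) \<le> sqrt (1/4)" by (rule real_sqrt_le_mono)
    then show "\<bar>t\<bar> \<le> 1/2" using L q by (simp add: t_def real_sqrt_divide)
  qed
  have tq: "t\<^sup>2 * q = L" using L q by (simp add: t_def)
  define W where "W s i \<omega> = exp (s * dev n (g i) \<omega>)" for s i \<omega>
  \<comment> \<open>The exponents \<open>t\<close> and \<open>- t\<close> control both signs of
    \<open>dev\<close>. By \<open>tq\<close> each \<open>W\<close> has mean at most
    \<open>exp L\<close>, and there are \<open>2 * card J \<le> exp L\<close> of them, so the
    weighted sum has mean at most 1 and \<open>V\<close> has mean at most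
    \<open>2 * L / t\<close>.\<close>
  define V where "V \<omega> = (2 * L - 1 + exp (- (2 * L)) * (\<Sum>i\<in>J. W t i \<omega> + W (- t) i \<omega>)) / t" for \<omega>
  have W: "integrable M (W s i)" "(\<integral>\<omega>. W s i \<omega> \<partial>M) \<le> exp L"
    if "i \<in> J" "s = t \<or> s = - t" for s i
    using mgf_dev_le[of "g i" A s n] g[OF that(1)] le[OF that(1)] t that(2) tq
    by (auto simp: W_def[abs_def] q_def[symmetric])
  have int_V: "integrable M V"
    unfolding V_def using W by (intro integrable_divide Bochner_Integration.integrable_add integrable_mult_right Bochner_Integration.integrable_sum) auto
  have V_ge: "\<bar>dev n (g i) \<omega>\<bar> \<le> V \<omega>" if i: "i \<in> J" for i \<omega>
  proof -
    have *: "c * dev n (g i) \<omega> \<le> V \<omega>" if c: "c = 1 \<or> c = -1" for c :: real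
    proof -
      have "t * (c * dev n (g i) \<omega>) \<le> 2 * L - 1 + exp (t * (c * dev n (g i) \<omega>) - 2 * L)"
        using exp_ge_add_one_self[of "t * (c * dev n (g i) \<omega>) - 2 * L"] by linarith
      also have "exp (t * (c * dev n (g i) \<omega>) - 2 * L) \<le> exp (- (2 * L)) * (W t i \<omega> + W (- t) i \<omega>)"
        using c by (auto simp: W_def exp_diff exp_minus divide_simps)
      also have "\<dots> \<le> exp (- (2 * L)) * (\<Sum>i\<in>J. W t i \<omega> + W (- t) i \<omega>)"
        using i J by (intro mult_left_mono member_le_sum) (auto simp: W_def add_nonneg_nonneg)
      finally have "t * (c * dev n (g i) \<omega>) \<le> t * V \<omega>" using t by (simp add: V_def)
      then show ?thesis using t by simp
    qed
    from *[of 1] *[of "-1"] show ?thesis by simp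
  qed
  show thesis
  proof
    show "V \<in> borel_measurable M" using int_V by simp
    show "\<bar>dev n (g i) \<omega>\<bar> \<le> V \<omega>" if "i \<in> J" for i \<omega> by (rule V_ge[OF that])
    show "(\<integral>\<^sup>+\<omega>. ennreal (V \<omega>) \<partial>M) \<le> ennreal (4 * sqrt (n * measure \<mu> A * L))"
    proof -
      obtain i where "i \<in> J" using J by auto
      then have V0: "0 \<le> V \<omega>" for \<omega> using V_ge[of i \<omega>] by linarith
      have "(\<integral>\<omega>. V \<omega> \<partial>M)
        = (2 * L - 1 + exp (- (2 * L)) * (\<Sum>i\<in>J. (\<integral>\<omega>. W t i \<omega> \<partial>M) + (\<integral>\<omega>. W (- t) i \<omega> \<partial>M))) / t"
        unfolding V_def using W by (simp add: prob_space)
      also have "\<dots> \<le> (2 * L - 1 + exp (- (2 * L)) * (\<Sum>i\<in>J. exp L + exp L)) / t"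
        using W t by (intro divide_right_mono add_left_mono mult_left_mono sum_mono add_mono) auto
      also have "(\<Sum>i\<in>J. exp L + exp L) = (2 * card J) * exp L" by simp
      also have "(2 * L - 1 + exp (- (2 * L)) * ((2 * card J) * exp L)) / t
          \<le> (2 * L - 1 + exp (- (2 * L)) * (exp L * exp L)) / t"
        using card t by (intro divide_right_mono add_left_mono mult_left_mono mult_right_mono) auto
      also have "\<dots> = 2 * L / t" by (simp add: mult_exp_exp)
      \<comment> \<open>The value is in fact \<open>2 * sqrt (q * L)\<close>; the constant 4 is the
        one reached in the other case, where \<open>2 * q\<close> is bounded using
        \<open>q < 4 * L\<close>.\<close>
      also have "\<dots> \<le> 4 * sqrt (q * L)"
      proof -
        have "L / t = L / sqrt L * sqrt q" by (simp add: t_def real_sqrt_divide)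
        also have "\<dots> = sqrt (q * L)" using L by (simp add: real_div_sqrt real_sqrt_mult)
        finally have "2 * L / t = 2 * sqrt (q * L)"
          by (simp only: times_divide_eq_right[symmetric])
        moreover have "0 \<le> sqrt (q * L)" using L q by simp
        ultimately show ?thesis by linarith
      qed
      finally show ?thesis
        by (simp add: nn_integral_eq_integral[OF int_V] V0 q_def ennreal_leI)
    qed
  qed
next
  case False
  \<comment> \<open>If \<open>A\<close> is hit too rarely for the exponential bound, counting the hits suffices.\<close>
  define q where "q = n * measure \<mu> A"
  have q: "0 \<le> q" "q < 4 * L" using False by (auto simp: q_def)
  define V where "V \<omega> = (\<Sum>k<n. indicator A (X k \<omega>) + measure \<mu> A)" for \<omega>
  have int_ind: "integrable \<mu> (indicator A :: real \<Rightarrow> real)"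
    by (intro integrable_bounded[where B=1]) (auto simp: indicator_def)
  have int: "integrable M (\<lambda>\<omega>. indicator A (X k \<omega>) :: real)" for k
    by (intro integrable_const_bound[of _ 1]) (auto simp: indicator_def)
  have int_V: "integrable M V" unfolding V_def using int by (intro Bochner_Integration.integrable_sum Bochner_Integration.integrable_add) auto
  show thesis
  proof
    show "V \<in> borel_measurable M" using int_V by simp
    fix i \<omega> assume i: "i \<in> J"
    have "norm (\<integral>x. g i x \<partial>\<mu>) \<le> (\<integral>x. indicator A x \<partial>\<mu>)"
    proof (rule Bochner_Integration.integral_norm_bound_integral[OF _ int_ind])
      show "integrable \<mu> (g i)"
        using g[OF i] order_trans[OF le[OF i]]
        by (intro integrable_bounded[where B=1]) (auto simp: indicator_def)
    qed (use le[OF i] in auto)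
    then have m: "\<bar>\<integral>x. g i x \<partial>\<mu>\<bar> \<le> measure \<mu> A" by simp
    show "\<bar>dev n (g i) \<omega>\<bar> \<le> V \<omega>"
      unfolding dev_def V_def
    proof (intro order_trans[OF sum_abs] sum_mono)
      fix k show "\<bar>g i (X k \<omega>) - (\<integral>x. g i x \<partial>\<mu>)\<bar> \<le> indicator A (X k \<omega>) + measure \<mu> A"
        using le[OF i, of "X k \<omega>"] m by linarith
    qed
  next
    have "(\<integral>\<omega>. V \<omega> \<partial>M) = 2 * q"
      unfolding V_def using int
      by (simp add: prob_space expectation_comp_X q_def algebra_simps sum.distrib)
    also have "\<dots> = 2 * (sqrt q * sqrt q)" using q by simp
    also have "\<dots> \<le> 2 * (sqrt q * sqrt (4 * L))"
      using q by (intro mult_left_mono) auto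
    also have "\<dots> = 4 * sqrt (q * L)" by (simp add: real_sqrt_mult)
    finally have "(\<integral>\<omega>. V \<omega> \<partial>M) \<le> 4 * sqrt (q * L)" .
    moreover have "0 \<le> V \<omega>" for \<omega> by (auto simp: V_def intro!: sum_nonneg)
    ultimately show "(\<integral>\<^sup>+\<omega>. ennreal (V \<omega>) \<partial>M) \<le> ennreal (4 * sqrt (n * measure \<mu> A * L))"
      by (simp add: nn_integral_eq_integral[OF int_V] q_def ennreal_leI)
  qed
qed


text \<open>Real and imaginary parts are treated as separate members of a real class. This doubles
  the cardinality, hence the 4 in the assumption on \<open>L\<close>, and doubles the constant from
  4 to 8.\<close>

lemma dev_bound_finite_class:
  fixes g :: "'i \<Rightarrow> real \<Rightarrow> complex"
  assumes I: "finite I" "I \<noteq> {}" and g: "\<And>i. i \<in> I \<Longrightarrow> g i \<in> borel_measurable borel"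
    and A: "A \<in> sets borel"
    and le: "\<And>i x. i \<in> I \<Longrightarrow> norm (g i x) \<le> indicator A x"
    and L: "0 < L" and card: "4 * card I \<le> exp L"
  shows "dev_bound n (g ` I) (ennreal (8 * sqrt (n * measure \<mu> A * L)))"
proof -
  define J where "J = I \<times> (UNIV :: bool set)"
  define G where "G p x = (if snd p then Re (g (fst p) x) else Im (g (fst p) x))" for p x
  obtain V where V: "V \<in> borel_measurable M"
    and dev_le: "\<And>p \<omega>. p \<in> J \<Longrightarrow> \<omega> \<in> space M \<Longrightarrow> \<bar>dev n (G p) \<omega>\<bar> \<le> V \<omega>"
    and EV: "(\<integral>\<^sup>+\<omega>. ennreal (V \<omega>) \<partial>M) \<le> ennreal (4 * sqrt (n * measure \<mu> A * L))"
  proof (rule finite_class_maximal_ineq[OF _ _ _ A _ L, of J G n])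
    show "finite J" "J \<noteq> {}" using I by (auto simp: J_def)
    show "real (2 * card J) \<le> exp L"
      using card by (simp add: J_def card_cartesian_product)
    fix p assume "p \<in> J"
    then have i: "fst p \<in> I" by (auto simp: J_def)
    show "G p \<in> borel_measurable borel"
      using g[OF i] unfolding G_def[abs_def] by measurable
    show "\<bar>G p x\<bar> \<le> indicator A x" for x
      using le[OF i, of x] abs_Re_le_cmod[of "g (fst p) x"] abs_Im_le_cmod[of "g (fst p) x"]
      by (simp add: G_def)
  qed (rule that)
  have "ennreal (norm (dev n (g i) \<omega>)) \<le> 2 * ennreal (V \<omega>)" if i: "i \<in> I" and \<omega>: "\<omega> \<in> space M" for i \<omega>
  proof -
    have int: "integrable \<mu> (g i)"
      using g[OF i] order_trans[OF le[OF i]]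
      by (intro integrable_bounded[where B=1]) (auto simp: indicator_def)
    have "Re (dev n (g i) \<omega>) = dev n (G (i, True)) \<omega>" "Im (dev n (g i) \<omega>) = dev n (G (i, False)) \<omega>"
      using int by (simp_all add: dev_def G_def Re_sum Im_sum integral_Re integral_Im)
    then have "norm (dev n (g i) \<omega>) \<le> V \<omega> + V \<omega>"
      using dev_le[of "(i, True)" \<omega>] dev_le[of "(i, False)" \<omega>] i \<omega> cmod_le[of "dev n (g i) \<omega>"]
      by (simp add: J_def)
    then show ?thesis
      using order_trans[OF abs_ge_zero dev_le[of "(i, True)" \<omega>]] i \<omega>
      by (simp add: J_def ennreal_leI flip: ennreal_plus ennreal_numeral ennreal_mult)
  qed
  moreover have "(\<integral>\<^sup>+\<omega>. 2 * ennreal (V \<omega>) \<partial>M) \<le> ennreal (8 * sqrt (n * measure \<mu> A * L))"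
  proof -
    have "(\<integral>\<^sup>+\<omega>. 2 * ennreal (V \<omega>) \<partial>M) = 2 * (\<integral>\<^sup>+\<omega>. ennreal (V \<omega>) \<partial>M)"
      using V by (intro nn_integral_cmult) auto
    also have "\<dots> \<le> 2 * ennreal (4 * sqrt (n * measure \<mu> A * L))"
      by (intro mult_left_mono EV) auto
    also have "\<dots> = ennreal (8 * sqrt (n * measure \<mu> A * L))"
      using L by (simp flip: ennreal_numeral ennreal_mult)
    finally show ?thesis .
  qed
  ultimately show ?thesis
    using V unfolding dev_bound_def
    by (intro bexI[of _ "\<lambda>\<omega>. 2 * ennreal (V \<omega>)"]) auto
qed

section \<open>Deviation bounds under scaling and series\<close>

lemma dev_bound_scale:
  assumes "dev_bound n F C" "0 \<le> b"
  shows "dev_bound n {\<lambda>x. c * f x | c f. norm c \<le> b \<and> f \<in> F} (ennreal b * C)"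
proof -
  obtain V where V: "V \<in> borel_measurable M"
    and le: "\<And>f \<omega>. f \<in> F \<Longrightarrow> \<omega> \<in> space M \<Longrightarrow> ennreal (norm (dev n f \<omega>)) \<le> V \<omega>"
    and EV: "(\<integral>\<^sup>+\<omega>. V \<omega> \<partial>M) \<le> C"
    using assms(1) unfolding dev_bound_def by blast
  have "ennreal (norm (dev n (\<lambda>x. c * f x) \<omega>)) \<le> ennreal b * V \<omega>"
    if "norm c \<le> b" "f \<in> F" "\<omega> \<in> space M" for c f \<omega>
  proof -
    have "dev n (\<lambda>x. c * f x) \<omega> = c * dev n f \<omega>"
      by (simp add: dev_def sum_distrib_left right_diff_distrib)
    then have "ennreal (norm (dev n (\<lambda>x. c * f x) \<omega>)) = ennreal (norm c) * ennreal (norm (dev n f \<omega>))"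
      by (simp add: norm_mult ennreal_mult)
    also have "\<dots> \<le> ennreal b * V \<omega>"
      using that le by (intro mult_mono ennreal_leI) auto
    finally show ?thesis .
  qed
  moreover have "(\<integral>\<^sup>+\<omega>. ennreal b * V \<omega> \<partial>M) \<le> ennreal b * C"
    using V EV by (simp add: nn_integral_cmult mult_left_mono)
  ultimately show ?thesis
    using V unfolding dev_bound_def
    by (intro bexI[of _ "\<lambda>\<omega>. ennreal b * V \<omega>"]) auto
qed

text \<open>Dominated convergence exchanges the series with the mean; the constant bounding all
  partial sums is the dominating function.\<close>

lemma dev_sums:
  fixes f :: "nat \<Rightarrow> real \<Rightarrow> complex"
  assumes meas: "\<And>q. f q \<in> borel_measurable borel"
    and sums: "\<And>x. (\<lambda>q. f q x) sums F x"
    and bound: "\<And>N x. norm (\<Sum>q<N. f q x) \<le> B"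
  shows "(\<lambda>q. dev n (f q) \<omega>) sums dev n F \<omega>"
proof -
  have int: "integrable \<mu> (f q)" for q
  proof (rule integrable_bounded[where B="B + B"])
    fix x
    \<comment> \<open>A term is the difference of two consecutive partial sums, whence the bound
      \<open>B + B\<close>.\<close>
    have "f q x = (\<Sum>q<Suc q. f q x) - (\<Sum>q<q. f q x)" by simp
    then show "norm (f q x) \<le> B + B"
      by (metis norm_triangle_ineq4 add_mono bound order_trans)
  qed (fact meas)
  have F: "F \<in> borel_measurable borel"
    by (rule borel_measurable_LIMSEQ_metric[OF _ sums[unfolded sums_def]]) (use meas in auto)
  have "(\<lambda>N. \<integral>x. (\<Sum>q<N. f q x) \<partial>\<mu>) \<longlonglongrightarrow> (\<integral>x. F x \<partial>\<mu>)"
    by (rule integral_dominated_convergence[where w="\<lambda>_. B"])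
       (use meas F bound sums in \<open>auto simp: sums_def\<close>)
  then have "(\<lambda>q. \<integral>x. f q x \<partial>\<mu>) sums (\<integral>x. F x \<partial>\<mu>)"
    using int by (simp add: sums_def)
  then show ?thesis
    unfolding dev_def by (intro sums_sum sums_diff sums)
qed

text \<open>The sum of the majorants is a majorant by the triangle inequality. The bound
  \<open>B\<close> may vary with \<open>f\<close>, since it only licenses \<open>dev_sums\<close>
  and does not enter the result. It is applied twice: to the power series on one shell and to the
  decomposition into shells.\<close>

lemma dev_bound_series:
  assumes G: "\<And>q. dev_bound n (G q) (C q)"
    and F: "\<And>f. f \<in> F \<Longrightarrow> \<exists>g B. (\<forall>q. g q \<in> G q \<and> g q \<in> borel_measurable borel) \<and>
      (\<forall>x. (\<lambda>q. g q x) sums f x) \<and> (\<forall>N x. norm (\<Sum>q<N. g q x) \<le> B)"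
  shows "dev_bound n F (\<Sum>q. C q)"
proof -
  obtain V where V: "\<And>q. V q \<in> borel_measurable M"
    and le: "\<And>q f \<omega>. f \<in> G q \<Longrightarrow> \<omega> \<in> space M \<Longrightarrow> ennreal (norm (dev n f \<omega>)) \<le> V q \<omega>"
    and EV: "\<And>q. (\<integral>\<^sup>+\<omega>. V q \<omega> \<partial>M) \<le> C q"
    using G unfolding dev_bound_def Bex_def by metis
  have "ennreal (norm (dev n f \<omega>)) \<le> (\<Sum>q. V q \<omega>)" if f: "f \<in> F" and \<omega>: "\<omega> \<in> space M" for f \<omega>
  proof -
    obtain g B where g: "\<And>q. g q \<in> G q" "\<And>q. g q \<in> borel_measurable borel"
        "\<And>x. (\<lambda>q. g q x) sums f x" "\<And>N x. norm (\<Sum>q<N. g q x) \<le> B"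
      using F[OF f] by blast
    have "(\<lambda>N. norm (\<Sum>q<N. dev n (g q) \<omega>)) \<longlonglongrightarrow> norm (dev n f \<omega>)"
      using dev_sums[OF g(2-4)] by (intro tendsto_norm) (simp add: sums_def)
    then have lim: "(\<lambda>N. ennreal (norm (\<Sum>q<N. dev n (g q) \<omega>))) \<longlonglongrightarrow> ennreal (norm (dev n f \<omega>))"
      by (rule tendsto_ennrealI)
    have "ennreal (norm (\<Sum>q<N. dev n (g q) \<omega>)) \<le> (\<Sum>q. V q \<omega>)" for N
    proof -
      have "ennreal (norm (\<Sum>q<N. dev n (g q) \<omega>)) \<le> ennreal (\<Sum>q<N. norm (dev n (g q) \<omega>))"
        by (intro ennreal_leI norm_sum)
      also have "\<dots> = (\<Sum>q<N. ennreal (norm (dev n (g q) \<omega>)))" by simp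
      also have "\<dots> \<le> (\<Sum>q<N. V q \<omega>)" using g(1) \<omega> le by (intro sum_mono) auto
      also have "\<dots> \<le> (\<Sum>q. V q \<omega>)" by (rule sum_le_suminf) auto
      finally show ?thesis .
    qed
    then show ?thesis by (intro LIMSEQ_le_const2[OF lim]) auto
  qed
  moreover have "(\<integral>\<^sup>+\<omega>. (\<Sum>q. V q \<omega>) \<partial>M) \<le> (\<Sum>q. C q)"
    using V EV by (simp add: nn_integral_suminf suminf_le)
  ultimately show ?thesis
    using V unfolding dev_bound_def
    by (intro bexI[of _ "\<lambda>\<omega>. \<Sum>q. V q \<omega>"]) auto
qed


section \<open>Trigonometric functions on a bounded set\<close>

lemma iexp_shift_sums:
  fixes y r a :: real
  shows "(\<lambda>m. (\<i> * r) ^ m / fact m * (y ^ m * iexp a)) sums iexp (a + r * y)"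
proof -
  have "(\<lambda>m. ((\<i> * r * y) ^ m /\<^sub>R fact m) * iexp a) sums (exp (\<i> * r * y) * iexp a)"
    by (intro sums_mult2 exp_converges)
  moreover have "exp (\<i> * r * y) * iexp a = iexp (a + r * y)"
    by (simp add: mult_exp_exp algebra_simps)
  ultimately show ?thesis
    by (simp add: power_mult_distrib scaleR_conv_of_real field_simps)
qed

text \<open>Write \<open>u * T = k + r\<close> with \<open>k\<close> an integer and \<open>r\<close>
  in [0,1], and expand \<open>iexp (u * x)\<close> in powers of \<open>r\<close>. The
  \<open>m\<close>-th term is the scalar \<open>(\<i> * r) ^ m / fact m\<close> times a function
  depending only on \<open>m\<close> and \<open>k\<close>, bounded by 1 on \<open>A\<close> because
  \<open>\<bar>x / T\<bar> \<le> 1\<close>. Each \<open>m\<close> thus needs one finite class, and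
  the weights \<open>1 / fact m\<close> sum to \<open>exp 1\<close>.\<close>

lemma dev_bound_trig_on_bounded:
  assumes A[measurable]: "A \<in> sets borel" and AT: "\<And>x. x \<in> A \<Longrightarrow> \<bar>x\<bar> \<le> T"
    and T: "0 < T" and U: "0 < U" and L: "0 < L" "8 * (U * T) + 12 \<le> exp L"
  shows "dev_bound n {\<lambda>x. indicator A x * iexp (u * x) | u. \<bar>u\<bar> \<le> U}
           (ennreal (8 * exp 1 * sqrt (n * measure \<mu> A * L)))"
proof -
  \<comment> \<open>The \<open>+ 1\<close> is for negative \<open>u\<close>, where rounding down can
    take \<open>k\<close> one below \<open>- \<lfloor>U * T\<rfloor>\<close>.\<close>
  define K where "K = \<lfloor>U * T\<rfloor> + 1"
  define g :: "nat \<Rightarrow> int \<Rightarrow> real \<Rightarrow> complex"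
    where "g m k x = indicator A x * ((x / T) ^ m * iexp (k / T * x))" for m k x
  define B where "B = ennreal (8 * sqrt (n * measure \<mu> A * L))"
  define G where "G m = {\<lambda>x. c * f x | c f. norm c \<le> 1 / fact m \<and> f \<in> g m ` {-K..K}}" for m
  have K: "0 < K" using U T by (simp add: K_def add_pos_nonneg)
  have meas_g[measurable]: "g m k \<in> borel_measurable borel" for m k
    unfolding g_def[abs_def] by measurable
  have g_le: "norm (g m k x) \<le> indicator A x" for m k x
  proof (cases "x \<in> A")
    case True
    have "\<bar>x / T\<bar> ^ m \<le> 1"
      using AT[OF True] T by (intro power_le_one) auto
    then show ?thesis
      using True by (simp add: g_def norm_mult norm_power norm_divide)
  qed (simp add: g_def)
  have fin: "dev_bound n (g m ` {-K..K}) B" for m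
    unfolding B_def
  proof (rule dev_bound_finite_class[OF _ _ _ A])
    show "norm (g m k x) \<le> indicator A x" for k x by (rule g_le)
    have "card {-K..K} = nat (2 * K + 1)" by simp
    then have "real (4 * card {-K..K}) = 8 * real_of_int K + 4" using K by simp
    \<comment> \<open>From \<open>K \<le> U * T + 1\<close>; this is the source of the constants 8
      and 12 in the assumption on \<open>L\<close>.\<close>
    also have "\<dots> \<le> 8 * (U * T) + 12" by (simp add: K_def)
    finally show "real (4 * card {-K..K}) \<le> exp L" using L by linarith
  qed (use K L in \<open>auto simp: meas_g\<close>)
  have "dev_bound n {\<lambda>x. indicator A x * iexp (u * x) | u. \<bar>u\<bar> \<le> U}
      (\<Sum>m. ennreal (1 / fact m) * B)"
  proof (rule dev_bound_series)
    show "dev_bound n (G m) (ennreal (1 / fact m) * B)" for m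
      unfolding G_def by (rule dev_bound_scale[OF fin]) simp
  next
    fix f assume "f \<in> {\<lambda>x. indicator A x * iexp (u * x) | u. \<bar>u\<bar> \<le> U} "
    then obtain u where u: "\<bar>u\<bar> \<le> U" and f: "f = (\<lambda>x. indicator A x * iexp (u * x))" by blast
    define k where "k = \<lfloor>u * T\<rfloor>"
    define r where "r = u * T - k"
    define h where "h m x = (\<i> * r) ^ m / fact m * g m k x" for m x
    have r: "0 \<le> r" "r \<le> 1" by (auto simp: r_def k_def) linarith
    have c: "norm ((\<i> * r) ^ m / fact m) \<le> 1 / fact m" for m
      using r by (simp add: norm_divide norm_power norm_mult power_le_one divide_right_mono)
    have k: "k \<in> {-K..K}"
    proof -
      have "\<bar>u * T\<bar> \<le> U * T" using u T by (simp add: abs_mult)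
      then show ?thesis unfolding k_def K_def by auto linarith+
    qed
    have h_le: "norm (h m x) \<le> 1 / fact m" for m x
    proof -
      have "norm (g m k x) \<le> 1"
        by (rule order_trans[OF g_le]) (simp add: indicator_def)
      then have "norm (h m x) \<le> 1 / fact m * 1"
        unfolding h_def norm_mult by (intro mult_mono c) auto
      then show ?thesis by simp
    qed
    show "\<exists>g B. (\<forall>q. g q \<in> G q \<and> g q \<in> borel_measurable borel) \<and>
      (\<forall>x. (\<lambda>q. g q x) sums f x) \<and> (\<forall>N x. norm (\<Sum>q<N. g q x) \<le> B)"
    proof (intro exI[of _ h] exI[of _ "exp 1"] conjI allI)
      show "h m \<in> G m" for m
        unfolding G_def h_def using c k by blast
      show "h m \<in> borel_measurable borel" for m
        unfolding h_def[abs_def] by measurable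
      show "(\<lambda>m. h m x) sums f x" for x
      proof -
        have "(\<lambda>m. (\<i> * r) ^ m / fact m * ((x / T) ^ m * iexp (k / T * x))) sums iexp (k / T * x + r * (x / T))"
          using iexp_shift_sums[of r "x / T" "k / T * x"] by simp
        also have "k / T * x + r * (x / T) = u * x"
          using T by (simp add: r_def field_simps)
        finally have "(\<lambda>m. indicator A x * ((\<i> * r) ^ m / fact m * ((x / T) ^ m * iexp (k / T * x)))) sums f x"
          unfolding f by (rule sums_mult)
        then show ?thesis by (simp add: h_def g_def mult_ac)
      qed
      show "norm (\<Sum>m<N. h m x) \<le> exp 1" for N x
      proof -
        have "norm (\<Sum>m<N. h m x) \<le> (\<Sum>m<N. 1 / fact m)"
          by (intro order_trans[OF norm_sum] sum_mono h_le)
        also have "\<dots> \<le> (\<Sum>m. 1 / fact m)"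
          using summable_exp[of "1::real"] by (intro sum_le_suminf) (auto simp: inverse_eq_divide)
        also have "\<dots> = exp 1" by (simp add: exp_def inverse_eq_divide)
        finally show ?thesis .
      qed
    qed
  qed
  also have "(\<Sum>m. ennreal (1 / fact m) * B) = ennreal (exp 1) * B"
  proof -
    have "(\<lambda>m. 1 / fact m :: real) sums exp 1"
      using exp_converges[of "1::real"] by (simp add: inverse_eq_divide)
    then have "(\<Sum>m. ennreal (1 / fact m)) = ennreal (exp 1)"
      by (intro suminf_ennreal_eq) auto
    then show ?thesis by (simp add: ennreal_suminf_multc)
  qed
  also have "\<dots> = ennreal (8 * exp 1 * sqrt (n * measure \<mu> A * L))"
    unfolding B_def using L by (simp flip: ennreal_mult add: mult_ac)
  finally show ?thesis .
qed


section \<open>Logarithmic shells and the bound on the whole line\<close>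

text \<open>The truncation at \<open>exp 1\<close> keeps the logarithm at least 1, so
  \<open>shell 0\<close> contains every \<open>x\<close> near 0 and the shells cover the line. Their
  doubly exponential radii make the log-cardinality on \<open>shell j\<close> of order
  \<open>2 ^ j\<close>.\<close>

definition shell :: "nat \<Rightarrow> real set"
  where "shell j = {x. 2 ^ j \<le> ln (max \<bar>x\<bar> (exp 1)) \<and> ln (max \<bar>x\<bar> (exp 1)) < 2 ^ Suc j}"

lemma shell_measurable [measurable]: "shell j \<in> sets borel"
  unfolding shell_def by measurable

lemma abs_le_of_shell: "x \<in> shell j \<Longrightarrow> \<bar>x\<bar> \<le> exp (2 ^ Suc j)"
proof -
  assume "x \<in> shell j"
  moreover have pos: "0 < max \<bar>x\<bar> (exp 1)" by (simp add: less_max_iff_disj)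
  ultimately have "max \<bar>x\<bar> (exp 1) < exp (2 ^ Suc j)"
    by (metis (no_types, lifting) exp_less_cancel_iff exp_ln mem_Collect_eq shell_def)
  then show ?thesis by simp
qed

lemma shell_unique: "\<exists>!j. x \<in> shell j"
proof -
  define l where "l = ln (max \<bar>x\<bar> (exp 1))"
  have l1: "1 \<le> l"
    unfolding l_def by (subst ln_ge_iff) (auto simp: less_max_iff_disj)
  \<comment> \<open>Minimality yields the lower bound \<open>2 ^ j \<le> l\<close>, except for
    \<open>j = 0\<close>, where it is \<open>l1\<close>.\<close>
  define j where "j = (LEAST j. l < 2 ^ Suc j)"
  obtain N where "l < 2 ^ N" using real_arch_pow[of 2 l] by auto
  then have "l < 2 ^ Suc N" using zero_less_power[of "2::real" N] by (simp del: zero_less_power)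
  then have up: "l < 2 ^ Suc j" unfolding j_def by (rule LeastI)
  have low: "2 ^ j \<le> l"
  proof (cases j)
    case 0
    then show ?thesis using l1 by simp
  next
    case (Suc i)
    then have "\<not> l < 2 ^ Suc i"
      using not_less_Least[of i "\<lambda>j. l < 2 ^ Suc j"] by (simp add: j_def)
    then show ?thesis using Suc by simp
  qed
  show ?thesis
  proof (rule ex1I)
    show "x \<in> shell j" using up low by (simp add: shell_def l_def)
    fix i assume i: "x \<in> shell i"
    have no: False if "a < b" "2 ^ b \<le> l" "l < 2 ^ Suc a" for a b
    proof -
      have "(2::real) ^ Suc a \<le> 2 ^ b" using that(1) by (intro power_increasing) auto
      then show False using that by linarith
    qed
    show "i = j"
      using no[of i j] no[of j i] i up low by (cases i j rule: linorder_cases) (auto simp: shell_def l_def)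
  qed
qed

text \<open>Markov's inequality for the logarithmic moment.\<close>

lemma measure_shell_le:
  assumes "integrable \<mu> (\<lambda>x. ln (max \<bar>x\<bar> (exp 1)) powr \<beta>)" "0 \<le> \<beta>"
  shows "(2 ^ j) powr \<beta> * measure \<mu> (shell j) \<le> (\<integral>x. ln (max \<bar>x\<bar> (exp 1)) powr \<beta> \<partial>\<mu>)"
proof -
  have "(2 ^ j) powr \<beta> * measure \<mu> (shell j) = (\<integral>x. (2 ^ j) powr \<beta> * indicator (shell j) x \<partial>\<mu>)"
    by simp
  also have "\<dots> \<le> (\<integral>x. ln (max \<bar>x\<bar> (exp 1)) powr \<beta> \<partial>\<mu>)"
  proof (intro integral_mono assms)
    show "integrable \<mu> (\<lambda>x. (2 ^ j) powr \<beta> * indicator (shell j) x)"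
      by (intro integrable_bounded[where B="(2 ^ j) powr \<beta>"]) (auto simp: indicator_def)
    fix x show "(2 ^ j) powr \<beta> * indicator (shell j) x \<le> ln (max \<bar>x\<bar> (exp 1)) powr \<beta>"
      using assms(2) by (cases "x \<in> shell j") (auto simp: shell_def intro!: powr_mono2)
  qed
  finally show ?thesis .
qed

lemma dev_bound_iexp:
  assumes mom: "integrable \<mu> (\<lambda>x. ln (max \<bar>x\<bar> (exp 1)) powr \<beta>)" and \<beta>: "1 < \<beta>"
  obtains C where "0 \<le> C"
    "\<And>n U. exp 1 \<le> U \<Longrightarrow> dev_bound n {\<lambda>x. iexp (u * x) | u. \<bar>u\<bar> \<le> U} (ennreal (C * sqrt (n * ln U)))"
proof -
  define m where "m = (\<integral>x. ln (max \<bar>x\<bar> (exp 1)) powr \<beta> \<partial>\<mu>)"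
  define r where "r = sqrt (2 powr (1 - \<beta>))"
  define D where "D = 8 * exp 1 * sqrt (6 * m)"
  have m0: "0 \<le> m" unfolding m_def by (intro Bochner_Integration.integral_nonneg) auto
  have r: "0 \<le> r" "r < 1"
    using powr_less_mono[of "1 - \<beta>" 0 2] \<beta> by (auto simp: r_def)
  have "dev_bound n {\<lambda>x. iexp (u * x) | u. \<bar>u\<bar> \<le> U} (ennreal (D / (1 - r) * sqrt (n * ln U)))"
    if U: "exp 1 \<le> U" for n U
  proof -
    have U0: "0 < U" using U less_le_trans[OF exp_gt_zero] by blast
    have lnU: "1 \<le> ln U" using U U0 by (simp add: ln_ge_iff)
    \<comment> \<open>A product, so that \<open>ln U\<close> factors out of the sum over
      \<open>j\<close>. The 6 is 3 + 1 + 2, since \<open>3 + ln U + 2 * 2 ^ j\<close> must stay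
      below \<open>L j\<close> while \<open>ln U\<close> and \<open>2 ^ j\<close> are at least
      1.\<close>
    define L where "L j = 6 * 2 ^ j * ln U" for j :: nat
    define G where "G j = {\<lambda>x. indicator (shell j) x * iexp (u * x) | u. \<bar>u\<bar> \<le> U}" for j
    have "dev_bound n {\<lambda>x. iexp (u * x) | u. \<bar>u\<bar> \<le> U} (\<Sum>j. ennreal (D * sqrt (n * ln U) * r ^ j))"
    proof (rule dev_bound_series)
      fix j
      have "dev_bound n (G j) (ennreal (8 * exp 1 * sqrt (n * measure \<mu> (shell j) * L j)))"
        unfolding G_def
      proof (rule dev_bound_trig_on_bounded[OF _ abs_le_of_shell])
        show "0 < L j" using lnU by (simp add: L_def)
        define E where "E = U * exp (2 ^ Suc j)"
        have e: "(5/2::real) \<le> exp 1" using exp_lower_Taylor_quadratic[of 1] by simp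
        have e3: "10 \<le> exp (3::real)"
        proof -
          have "(5/2::real) ^ 3 \<le> exp 1 ^ 3" using e by (intro power_mono) auto
          also have "exp 1 ^ 3 = exp (3::real)" by (simp add: exp_of_nat_mult[symmetric])
          finally show ?thesis by (simp add: power3_eq_cube)
        qed
        \<comment> \<open>As \<open>E\<close> is at least \<open>exp 3 \<ge> 10\<close>, the 12 is
          absorbed into \<open>2 * E\<close>, and \<open>10 * E \<le> exp 3 * E\<close>.\<close>
        have "exp 1 * exp 2 \<le> E"
          unfolding E_def using U U0 by (intro mult_mono) (auto simp: self_le_power)
        then have "exp 3 \<le> E" by (simp add: mult_exp_exp)
        then have "8 * E + 12 \<le> exp 3 * E"
          using e3 mult_right_mono[OF e3, of E] by linarith
        also have "\<dots> = exp (3 + ln U + 2 * 2 ^ j)"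
          using U0 by (simp add: E_def exp_add)
        also have "\<dots> \<le> exp (L j)"
        proof -
          define p where "p = (2::real) ^ j"
          define q where "q = p * ln U"
          have "1 \<le> p" by (simp add: p_def)
          then have "ln U \<le> q" "p \<le> q"
            using lnU mult_right_mono[of 1 p "ln U"] mult_left_mono[OF lnU, of p] by (simp_all add: q_def)
          then have "3 + ln U + 2 * p \<le> 6 * q" using lnU by linarith
          then show ?thesis by (simp add: L_def p_def q_def)
        qed
        finally show "8 * (U * exp (2 ^ Suc j)) + 12 \<le> exp (L j)" by (simp add: E_def)
      qed (use U0 in auto)
      moreover have "8 * exp 1 * sqrt (n * measure \<mu> (shell j) * L j) \<le> D * sqrt (n * ln U) * r ^ j"
      proof -
        define p where "p = measure \<mu> (shell j)"
        \<comment> \<open>The log-cardinality factor \<open>2 ^ j\<close> times the probability of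
          the shell leaves \<open>2 powr (1 - \<beta>)\<close> to the power \<open>j\<close>; its
          square root is \<open>r ^ j\<close>, summable because \<open>\<beta> > 1\<close>.\<close>
        have "(2 ^ j) powr \<beta> * p \<le> m"
          using measure_shell_le[OF mom, of j] \<beta> by (simp add: p_def m_def)
        then have "(2 ^ j) powr (1 - \<beta>) * ((2 ^ j) powr \<beta> * p) \<le> (2 ^ j) powr (1 - \<beta>) * m"
          by (intro mult_left_mono) auto
        moreover have "(2 ^ j) powr (1 - \<beta>) * ((2 ^ j) powr \<beta> * p) = 2 ^ j * p"
          by (simp add: mult.assoc[symmetric] powr_add[symmetric])
        moreover have "(2 ^ j) powr (1 - \<beta>) = (2 powr (1 - \<beta>)) ^ j"
          by (simp add: powr_realpow[symmetric] powr_powr mult.commute)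
        ultimately have pm: "2 ^ j * p \<le> m * (2 powr (1 - \<beta>)) ^ j"
          by (metis mult.commute)
        have "n * p * L j = 6 * (n * ln U) * (2 ^ j * p)" by (simp add: L_def)
        also have "\<dots> \<le> 6 * (n * ln U) * (m * (2 powr (1 - \<beta>)) ^ j)"
          using pm lnU by (intro mult_left_mono) auto
        finally have "sqrt (n * p * L j) \<le> sqrt (6 * (n * ln U) * (m * (2 powr (1 - \<beta>)) ^ j))"
          by (rule real_sqrt_le_mono)
        also have "\<dots> = sqrt (6 * m) * sqrt (n * ln U) * r ^ j"
          by (simp add: real_sqrt_mult real_sqrt_power r_def)
        finally show ?thesis by (simp add: D_def p_def)
      qed
      ultimately show "dev_bound n (G j) (ennreal (D * sqrt (n * ln U) * r ^ j))"
        by (auto intro: dev_bound_mono ennreal_leI)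
    next
      fix f assume "f \<in> {\<lambda>x. iexp (u * x) | u. \<bar>u\<bar> \<le> U}"
      then obtain u where u: "\<bar>u\<bar> \<le> U" and f: "f = (\<lambda>x. iexp (u * x))" by blast
      define g :: "nat \<Rightarrow> real \<Rightarrow> complex" where "g j x = indicator (shell j) x * iexp (u * x)" for j x
      show "\<exists>g B. (\<forall>q. g q \<in> G q \<and> g q \<in> borel_measurable borel) \<and>
        (\<forall>x. (\<lambda>q. g q x) sums f x) \<and> (\<forall>N x. norm (\<Sum>q<N. g q x) \<le> B)"
      proof (intro exI[of _ g] exI[of _ 1] conjI allI)
        show "g j \<in> G j" for j unfolding G_def g_def using u by blast
        show "g j \<in> borel_measurable borel" for j unfolding g_def[abs_def] by measurable
        fix x
        obtain i where i: "\<And>j. x \<in> shell j \<longleftrightarrow> j = i" using shell_unique[of x] by metis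
        then have g: "g j x = (if j = i then f x else 0)" for j by (simp add: g_def f)
        show "(\<lambda>j. g j x) sums f x" unfolding g by (rule sums_single)
        show "norm (\<Sum>j<N. g j x) \<le> 1" for N unfolding g by (simp add: f)
      qed
    qed
    also have "(\<Sum>j. ennreal (D * sqrt (n * ln U) * r ^ j)) = ennreal (D / (1 - r) * sqrt (n * ln U))"
    proof (rule suminf_ennreal_eq)
      show "(\<lambda>j. D * sqrt (n * ln U) * r ^ j) sums (D / (1 - r) * sqrt (n * ln U))"
        using sums_mult[OF geometric_sums[of r], of "D * sqrt (n * ln U)"] r by (simp add: field_simps)
      show "0 \<le> D * sqrt (n * ln U) * r ^ j" for j
        using m0 r lnU by (simp add: D_def)
    qed
    finally show ?thesis .
  qed
  moreover have "0 \<le> D / (1 - r)" using m0 r by (simp add: D_def)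
  ultimately show thesis by (rule that[rotated])
qed

end

section \<open>From expected suprema to events and the rate of the remainder\<close>

lemma (in prob_space) prob_gt_le_of_nn_integral:
  fixes V :: "'a \<Rightarrow> ennreal"
  assumes [measurable]: "V \<in> borel_measurable M" and V: "(\<integral>\<^sup>+\<omega>. V \<omega> \<partial>M) \<le> ennreal b"
    and t: "0 < t" and b: "0 \<le> b"
  shows "prob {\<omega> \<in> space M. ennreal t < V \<omega>} \<le> b / t"
proof -
  have one: "1 \<le> ennreal (1 / t) * V \<omega>" if "ennreal t < V \<omega>" for \<omega>
  proof -
    have "1 = ennreal (1 / t) * ennreal t" using t by (simp flip: ennreal_mult)
    also have "\<dots> \<le> ennreal (1 / t) * V \<omega>" using that by (intro mult_left_mono) auto
    finally show ?thesis .
  qed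
  have "emeasure M {\<omega> \<in> space M. ennreal t < V \<omega>} \<le> emeasure M {\<omega> \<in> space M. 1 \<le> ennreal (1 / t) * V \<omega>}"
    using one by (intro emeasure_mono) auto
  also have "\<dots> \<le> ennreal (1 / t) * (\<integral>\<^sup>+\<omega>. V \<omega> * indicator (space M) \<omega> \<partial>M)"
    by (rule nn_integral_Markov_inequality) auto
  also have "(\<integral>\<^sup>+\<omega>. V \<omega> * indicator (space M) \<omega> \<partial>M) = (\<integral>\<^sup>+\<omega>. V \<omega> \<partial>M)"
    by (intro nn_integral_cong) auto
  also have "ennreal (1 / t) * (\<integral>\<^sup>+\<omega>. V \<omega> \<partial>M) \<le> ennreal (1 / t) * ennreal b"
    by (intro mult_left_mono V) auto
  also have "\<dots> = ennreal (b / t)" using t b by (simp flip: ennreal_mult)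
  finally show ?thesis
    using t b by (simp add: emeasure_eq_measure ennreal_le_iff)
qed

theorem theorem3p2:
  fixes M :: "'a measure" and \<xi> :: "nat \<Rightarrow> 'a \<Rightarrow> real"
    and h :: "nat \<Rightarrow> real" and \<delta> \<beta> :: real
  defines "\<phi> \<equiv> char (distr M borel (\<xi> 0))"
  assumes "prob_space M"
    and indep: "prob_space.indep_vars M (\<lambda>_. borel) \<xi> UNIV"
    and ident: "\<And>k. distr M borel (\<xi> k) = distr M borel (\<xi> 0)"
    and inf_pos: "\<exists>c>0. \<forall>u. c \<le> cmod (\<phi> u)"
    and h_pos: "\<And>n. h n > 0"
    and h_lim: "h \<longlonglongrightarrow> 0"
    and \<delta>_pos: "\<delta> > 0"
    and h_rate: "(\<lambda>n. ln (1 / h n) / real n powr (1 / (1 + 2 * \<delta>))) \<longlonglongrightarrow> 0"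
    and \<beta>: "\<beta> > 1"
    and moment: "integrable M (\<lambda>\<omega>. (ln (max \<bar>\<xi> 0 \<omega>\<bar> (exp 1))) powr \<beta>)"
  shows "\<exists>E :: nat \<Rightarrow> 'a set.
     (\<forall>n. E n \<in> sets M) \<and> (\<lambda>n. measure M (E n)) \<longlonglongrightarrow> 1 \<and>
     (\<forall>n. \<forall>\<omega>\<in>E n.
        (\<forall>u. \<bar>u\<bar> \<le> 1 / h n \<longrightarrow> emp_char \<xi> n \<omega> u / \<phi> u \<noteq> 0) \<and>
        (\<exists>!L. dist_log_prop (1 / h n) (\<lambda>u. emp_char \<xi> n \<omega> u / \<phi> u) L) \<and>
        (\<forall>u. \<bar>u\<bar> \<le> 1 / h n \<longrightarrow>
           dist_log (1 / h n) (\<lambda>v. emp_char \<xi> n \<omega> v / \<phi> v) u =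
             (emp_char \<xi> n \<omega> u - \<phi> u) / \<phi> u + Rfun (emp_char \<xi> n \<omega> u / \<phi> u))) \<and>
     (\<forall>\<delta>'. 0 < \<delta>' \<and> \<delta>' \<le> \<delta> \<longrightarrow>
        (\<forall>\<epsilon>>0. \<exists>K. \<forall>\<^sub>F n in sequentially. \<exists>A\<in>sets M. measure M A < \<epsilon> \<and>
           {\<omega>\<in>E n. \<exists>u. \<bar>u\<bar> \<le> 1 / h n \<and>
              cmod (Rfun (emp_char \<xi> n \<omega> u / \<phi> u)) > K * (ln (1 / h n) powr (1 + 2 * \<delta>') / real n)}
           \<subseteq> A))"
proof -
  define \<mu> where "\<mu> = distr M borel (\<xi> 0)"
  define U where "U n = 1 / h n" for n
  interpret S: iid_sample M \<xi> \<mu>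
    using assms(2) indep ident by (simp add: iid_sample_def iid_sample_axioms_def \<mu>_def)
  have \<phi>_char: "\<phi> = char \<mu>" by (simp add: \<phi>_def \<mu>_def)
  obtain c where c: "0 < c" "\<And>u. c \<le> norm (\<phi> u)" using inf_pos by blast
  have \<phi>_nz: "\<phi> u \<noteq> 0" for u using c(1) c(2)[of u] by auto
  have mom: "integrable \<mu> (\<lambda>x. ln (max \<bar>x\<bar> (exp 1)) powr \<beta>)"
    unfolding \<mu>_def using moment by (subst integrable_distr_eq) auto
  obtain C where C: "0 \<le> C"
    and bound: "\<And>n U. exp 1 \<le> U \<Longrightarrow>
      S.dev_bound n {\<lambda>x. iexp (u * x) | u. \<bar>u\<bar> \<le> U} (ennreal (C * sqrt (n * ln U)))"
    by (rule S.dev_bound_iexp[OF mom \<beta>]) (rule that)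
  \<comment> \<open>Where \<open>U n < exp 1\<close> no bound is available and \<open>V\<close>
    defaults to 0, making it total in \<open>n\<close>. Only finitely many \<open>n\<close> are
    affected, as \<open>U\<close> tends to infinity.\<close>
  have "\<exists>V. V \<in> borel_measurable M \<and> (exp 1 \<le> U n \<longrightarrow>
      (\<forall>\<omega>\<in>space M. \<forall>u. \<bar>u\<bar> \<le> U n \<longrightarrow> ennreal (norm (S.dev n (\<lambda>x. iexp (u * x)) \<omega>)) \<le> V \<omega>) \<and>
      (\<integral>\<^sup>+\<omega>. V \<omega> \<partial>M) \<le> ennreal (C * sqrt (n * ln (U n))))" for n
  proof (cases "exp 1 \<le> U n")
    case True
    from bound[OF True, of n] show ?thesis
      unfolding S.dev_bound_def by blast
  qed (auto intro!: exI[of _ "\<lambda>_. 0"])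
  then obtain V where V[measurable]: "\<And>n. V n \<in> borel_measurable M"
    and dev_le: "\<And>n \<omega> u. exp 1 \<le> U n \<Longrightarrow> \<omega> \<in> space M \<Longrightarrow> \<bar>u\<bar> \<le> U n \<Longrightarrow>
      ennreal (norm (S.dev n (\<lambda>x. iexp (u * x)) \<omega>)) \<le> V n \<omega>"
    and EV: "\<And>n. exp 1 \<le> U n \<Longrightarrow> (\<integral>\<^sup>+\<omega>. V n \<omega> \<partial>M) \<le> ennreal (C * sqrt (n * ln (U n)))"
    by metis
  have lnU: "1 \<le> ln (U n)" if "exp 1 \<le> U n" for n
    using that less_le_trans[OF exp_gt_zero that] by (simp add: ln_ge_iff)
  have tail: "measure M {\<omega> \<in> space M. ennreal t < V n \<omega>} \<le> C * sqrt (n * ln (U n)) / t"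
    if "exp 1 \<le> U n" "0 < t" for n t
    using C lnU[OF that(1)] by (intro S.prob_gt_le_of_nn_integral V EV that) auto
  \<comment> \<open>The quotient minus 1 equals \<open>dev\<close> divided by
    \<open>n * \<phi> u\<close>, and \<open>c\<close> bounds \<open>\<phi>\<close> away from
    0.\<close>
  have ratio: "norm (emp_char \<xi> n \<omega> u / \<phi> u - 1) \<le> b / (n * c)"
    if n: "1 \<le> n" "exp 1 \<le> U n" and \<omega>: "\<omega> \<in> space M" "V n \<omega> \<le> ennreal b" and b: "0 \<le> b"
      and u: "\<bar>u\<bar> \<le> U n" for n \<omega> b u
  proof -
    define D where "D = S.dev n (\<lambda>x. iexp (u * x)) \<omega>"
    have "ennreal (norm D) \<le> ennreal b"
      using dev_le[OF n(2) \<omega>(1) u] \<omega>(2) unfolding D_def by (rule order_trans)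
    then have D: "norm D \<le> b" using b by (simp add: ennreal_le_iff)
    have "D = (\<Sum>k<n. iexp (u * \<xi> k \<omega>)) - n * \<phi> u"
      by (simp add: D_def S.dev_def sum_subtractf \<phi>_char char_def)
    then have "emp_char \<xi> n \<omega> u / \<phi> u - 1 = D / (n * \<phi> u)"
      using n \<phi>_nz[of u] by (simp add: emp_char_def field_simps)
    then have "norm (emp_char \<xi> n \<omega> u / \<phi> u - 1) = norm D / (n * norm (\<phi> u))"
      by (simp add: norm_divide norm_mult)
    also have "\<dots> \<le> b / (n * c)"
      using n c D b by (intro frac_le mult_left_mono) auto
    finally show ?thesis .
  qed
  have U_top: "filterlim U at_top sequentially"
  proof -
    have "filterlim h (at_right 0) sequentially"
      using h_lim h_pos by (simp add: filterlim_at less_imp_neq[THEN not_sym])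
    then show ?thesis
      unfolding U_def inverse_eq_divide[symmetric]
      by (rule filterlim_compose[OF filterlim_inverse_at_top_right])
  qed
  have ev: "\<forall>\<^sub>F n in sequentially. 1 \<le> n \<and> exp 1 \<le> U n"
    using U_top by (intro eventually_conj eventually_ge_at_top) (auto simp: filterlim_at_top)
  define good where "good n \<longleftrightarrow> 1 \<le> n \<and> exp 1 \<le> U n" for n
  \<comment> \<open>The threshold \<open>n * c / 2\<close> turns \<open>ratio\<close> into the bound
    1/2 demanded by \<open>norm_Rfun_le\<close>. Taking the empty set for the finitely many other
    \<open>n\<close> lets the representation hold on \<open>E n\<close> for all
    \<open>n\<close>.\<close>
  define E where "E n = (if good n then {\<omega> \<in> space M. V n \<omega> \<le> ennreal (n * c / 2)} else {})" for n
  have E_sets: "E n \<in> sets M" for n unfolding E_def by auto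
  have near: "norm (emp_char \<xi> n \<omega> u / \<phi> u - 1) \<le> 1/2"
    if "\<omega> \<in> E n" "\<bar>u\<bar> \<le> U n" for n \<omega> u
    using that ratio[of n \<omega> "n * c / 2" u] c(1)
    by (auto simp: E_def good_def split: if_splits)
  have E_lim: "(\<lambda>n. measure M (E n)) \<longlonglongrightarrow> 1"
  proof (rule tendsto_sandwich[OF _ _ _ tendsto_const])
    \<comment> \<open>As \<open>a < 1\<close>, multiplying the rate assumption by
      \<open>real n powr (a - 1)\<close> gives that \<open>ln (U n) / n\<close> tends to 0. Markov's
      inequality bounds the probability of missing \<open>E n\<close> by a multiple of the square
      root of this.\<close>
    define a where "a = 1 / (1 + 2 * \<delta>)"
    have a: "a - 1 < 0" using \<delta>_pos by (simp add: a_def)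
    have "(\<lambda>n. ln (U n) / real n powr a * real n powr (a - 1)) \<longlonglongrightarrow> 0 * 0"
      using h_rate a
      by (intro tendsto_mult tendsto_neg_powr filterlim_real_sequentially) (auto simp: U_def a_def)
    moreover have "ln (U n) / real n powr a * real n powr (a - 1) = ln (U n) / n" for n
      by (cases "n = 0") (auto simp: powr_diff)
    ultimately have "(\<lambda>n. ln (U n) / n) \<longlonglongrightarrow> 0" by simp
    then have "(\<lambda>n. 1 - 2 * C / c * sqrt (ln (U n) / n)) \<longlonglongrightarrow> 1 - 2 * C / c * sqrt 0"
      by (intro tendsto_intros)
    then show "(\<lambda>n. 1 - 2 * C / c * sqrt (ln (U n) / n)) \<longlonglongrightarrow> 1" by simp
    show "\<forall>\<^sub>F n in sequentially. measure M (E n) \<le> 1" by simp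
    show "\<forall>\<^sub>F n in sequentially. 1 - 2 * C / c * sqrt (ln (U n) / n) \<le> measure M (E n)"
      using ev
    proof eventually_elim
      case (elim n)
      have "sqrt (n * ln (U n)) / n = sqrt (ln (U n) / n)"
      proof -
        have "sqrt (n * ln (U n)) / n = (sqrt n / n) * sqrt (ln (U n))" by (simp add: real_sqrt_mult)
        also have "sqrt n / n = 1 / sqrt n" using elim by (simp add: sqrt_divide_self_eq inverse_eq_divide)
        finally show ?thesis by (simp add: real_sqrt_divide)
      qed
      then have "C * sqrt (n * ln (U n)) / (n * c / 2) = 2 * C / c * sqrt (ln (U n) / n)"
        using elim c(1) by (simp add: field_simps)
      moreover have "measure M (E n) = 1 - measure M {\<omega> \<in> space M. ennreal (n * c / 2) < V n \<omega>}"
      proof -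
        have "E n = space M - {\<omega> \<in> space M. ennreal (n * c / 2) < V n \<omega>}"
          using elim by (auto simp: E_def good_def not_less)
        then show ?thesis by (simp add: S.prob_compl)
      qed
      ultimately show ?case
        using tail[of n "n * c / 2"] elim c(1) by simp
    qed
  qed
  have rep: "(\<forall>u. \<bar>u\<bar> \<le> U n \<longrightarrow> emp_char \<xi> n \<omega> u / \<phi> u \<noteq> 0) \<and>
      (\<exists>!L. dist_log_prop (U n) (\<lambda>u. emp_char \<xi> n \<omega> u / \<phi> u) L) \<and>
      (\<forall>u. \<bar>u\<bar> \<le> U n \<longrightarrow>
         dist_log (U n) (\<lambda>v. emp_char \<xi> n \<omega> v / \<phi> v) u =
           (emp_char \<xi> n \<omega> u - \<phi> u) / \<phi> u + Rfun (emp_char \<xi> n \<omega> u / \<phi> u))"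
    if \<omega>: "\<omega> \<in> E n" for n \<omega>
  proof -
    define \<psi> where "\<psi> u = emp_char \<xi> n \<omega> u / \<phi> u" for u
    have n: "1 \<le> n" using \<omega> by (auto simp: E_def good_def split: if_splits)
    have U0: "0 < U n" using h_pos by (simp add: U_def)
    have lt: "norm (\<psi> u - 1) < 1" if "\<bar>u\<bar> \<le> U n" for u
      using near[OF \<omega> that] by (simp add: \<psi>_def)
    have "continuous_on {- U n..U n} \<psi>"
      unfolding \<psi>_def emp_char_def
    proof (intro continuous_on_divide)
      show "continuous_on {- U n..U n} \<phi>"
        unfolding \<phi>_char by (intro continuous_at_imp_continuous_on ballI S.D.isCont_char)
    qed (use \<phi>_nz n in \<open>auto intro!: continuous_intros\<close>)
    moreover have "\<psi> 0 = 1"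
      using n S.D.char_zero by (simp add: \<psi>_def emp_char_def \<phi>_char)
    ultimately have log: "\<exists>!L. dist_log_prop (U n) \<psi> L"
        "\<And>u. \<bar>u\<bar> \<le> U n \<Longrightarrow> dist_log (U n) \<psi> u = Ln (\<psi> u)"
      using dist_log_near_one[OF U0 _ _ lt] by auto
    have "\<psi> u \<noteq> 0" if "\<bar>u\<bar> \<le> U n" for u using lt[OF that] by auto
    \<comment> \<open>Here \<open>Ln z = (z - 1) + Rfun z\<close>, and \<open>z - 1\<close> is the
      linear term.\<close>
    moreover have "dist_log (U n) \<psi> u = (emp_char \<xi> n \<omega> u - \<phi> u) / \<phi> u + Rfun (\<psi> u)" if "\<bar>u\<bar> \<le> U n" for u
      using log(2)[OF that] Rfun_eq[OF lt[OF that]] \<phi>_nz[of u] by (simp add: \<psi>_def diff_divide_distrib)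
    ultimately show ?thesis using log(1) unfolding \<psi>_def by blast
  qed
  have rate: "\<exists>K. \<forall>\<^sub>F n in sequentially. \<exists>A\<in>sets M. measure M A < \<epsilon> \<and>
      {\<omega>\<in>E n. \<exists>u. \<bar>u\<bar> \<le> U n \<and>
        norm (Rfun (emp_char \<xi> n \<omega> u / \<phi> u)) > K * (ln (U n) powr (1 + 2 * \<delta>') / real n)} \<subseteq> A"
    if \<delta>': "0 < \<delta>'" and \<epsilon>: "0 < \<epsilon>" for \<delta>' \<epsilon>
  proof -
    \<comment> \<open>Markov's inequality at level \<open>k * sqrt (n * l)\<close> gives probability
      at most \<open>C / k\<close>. The \<open>+ 1\<close> makes this strictly less than
      \<open>\<epsilon>\<close> and keeps \<open>k\<close> positive when
      \<open>C = 0\<close>.\<close>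
    define k where "k = C / \<epsilon> + 1"
    have k: "0 < k" "C / k < \<epsilon>"
      using C \<epsilon> by (auto simp: k_def field_simps add_pos_nonneg)
    \<comment> \<open>When \<open>V n\<close> is at most \<open>t\<close>, \<open>ratio\<close>
      gives \<open>t / (n * c)\<close>; its square times the 4 of \<open>norm_Rfun_le\<close> is
      this constant times \<open>l / n\<close>.\<close>
    show ?thesis
    proof (rule exI[of _ "4 * k\<^sup>2 / c\<^sup>2"], rule eventually_mono[OF ev])
      fix n assume n: "1 \<le> n \<and> exp 1 \<le> U n"
      define l where "l = ln (U n)"
      have l: "1 \<le> l" using lnU n by (simp add: l_def)
      define t where "t = k * sqrt (n * l)"
      have t: "0 < t" using k l n by (simp add: t_def)
      have "measure M {\<omega> \<in> space M. ennreal t < V n \<omega>} \<le> C * sqrt (n * l) / t"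
        using tail[of n t] n t by (simp add: l_def)
      also have "\<dots> = C / k" using n l by (simp add: t_def)
      finally have small: "measure M {\<omega> \<in> space M. ennreal t < V n \<omega>} < \<epsilon>" using k by simp
      have R: "norm (Rfun (emp_char \<xi> n \<omega> u / \<phi> u)) \<le> 4 * k\<^sup>2 / c\<^sup>2 * (l powr (1 + 2 * \<delta>') / real n)"
        if \<omega>: "\<omega> \<in> E n" "V n \<omega> \<le> ennreal t" and u: "\<bar>u\<bar> \<le> U n" for \<omega> u
      proof -
        have sp: "\<omega> \<in> space M" using \<omega> by (auto simp: E_def split: if_splits)
        have "norm (Rfun (emp_char \<xi> n \<omega> u / \<phi> u)) \<le> 4 * (norm (emp_char \<xi> n \<omega> u / \<phi> u - 1))\<^sup>2"
          by (rule norm_Rfun_le[OF near[OF \<omega>(1) u]])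
        also have "\<dots> \<le> 4 * (t / (n * c))\<^sup>2"
          using ratio[of n \<omega> t u] n sp \<omega>(2) t u by (intro mult_left_mono power_mono) auto
        also have "\<dots> = 4 * k\<^sup>2 / c\<^sup>2 * (l powr 1 / real n)"
          using l n by (simp add: t_def power_divide power_mult_distrib) (simp add: power2_eq_square mult_ac)
        \<comment> \<open>Since \<open>l \<ge> 1\<close>, raising the exponent from 1 to
          \<open>1 + 2 * \<delta>'\<close> only enlarges the bound.\<close>
        also have "\<dots> \<le> 4 * k\<^sup>2 / c\<^sup>2 * (l powr (1 + 2 * \<delta>') / real n)"
          using l \<delta>' by (intro mult_left_mono divide_right_mono powr_mono) auto
        finally show ?thesis .
      qed
      show "\<exists>A\<in>sets M. measure M A < \<epsilon> \<and>
        {\<omega>\<in>E n. \<exists>u. \<bar>u\<bar> \<le> U n \<and>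
          norm (Rfun (emp_char \<xi> n \<omega> u / \<phi> u)) > 4 * k\<^sup>2 / c\<^sup>2 * (ln (U n) powr (1 + 2 * \<delta>') / real n)} \<subseteq> A"
      \<comment> \<open>The exceptional set is a level set of the measurable \<open>V n\<close>,
        which avoids measurability of a supremum over uncountably many \<open>u\<close>.\<close>
      proof (intro bexI[of _ "{\<omega> \<in> space M. ennreal t < V n \<omega>}"] conjI small subsetI)
        fix \<omega> assume "\<omega> \<in> {\<omega>\<in>E n. \<exists>u. \<bar>u\<bar> \<le> U n \<and>
          norm (Rfun (emp_char \<xi> n \<omega> u / \<phi> u)) > 4 * k\<^sup>2 / c\<^sup>2 * (ln (U n) powr (1 + 2 * \<delta>') / real n)}"
        then show "\<omega> \<in> {\<omega> \<in> space M. ennreal t < V n \<omega>}"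
          using R[of \<omega>] sets.sets_into_space[OF E_sets[of n]]
          by (auto simp: l_def not_less[symmetric])
      qed simp
    qed
  qed
  show ?thesis
    using E_sets E_lim rep rate unfolding U_def by (intro exI[of _ E]) auto
qed

end
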